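(* For every positive integer $k$, the odd cycle $C_{2k+1}$ is uniquely vector colorable.
   Context: For $t\ge2$, a vector $t$-coloring of a graph $G=([n],E)$ is an assignment of real unit vectors $p_i$ with $p_i^Tp_j\le-1/(t-1)$ for all edges $ij$. The vector chromatic number $\chi_v(G)$ is the least $t$ admitting a vector $t$-coloring, and a vector coloring is optimal if it is a vector $\chi_v(G)$-coloring. $G$ is uniquely vector colorable if any two optimal vector colorings $\mathbf p,\mathbf q$ satisfy $p_i^Tp_j=q_i^Tq_j$ for all $i,j$. *)

theory Defs
  imports Complex_Main "Jordan_Normal_Form.Matrix"
begin

type_synonym 'a ugraph = "'a set \<times> 'a set set"

abbreviation vertices :: "'a ugraph \<Rightarrow> 'a set" where
  "vertices G \<equiv> fst G"

abbreviation edges :: "'a ugraph \<Rightarrow> 'a set set" where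
  "edges G \<equiv> snd G"

definition simple_graph :: "'a ugraph \<Rightarrow> bool" where
  "simple_graph G \<longleftrightarrow> finite (vertices G) \<and> (\<forall>e\<in>edges G. e \<subseteq> vertices G \<and> card e = 2)"

(* Intended for n at least 3; smaller n give degenerate edge sets. *)
definition cycle_graph :: "nat \<Rightarrow> nat ugraph" where
  "cycle_graph n = ({1..n}, insert {n, 1} {{i, Suc i} | i. 1 \<le> i \<and> i < n})"

lemma simple_graph_cycle_graph:
  assumes "n \<ge> 3"
  shows "simple_graph (cycle_graph n)"
  using assms by (auto simp: simple_graph_def cycle_graph_def)

(* The dimension d of the ambient Euclidean space is arbitrary; it may differ between
   two colorings of the same graph. Values of p outside the vertex set are irrelevant. *)
definition vector_coloring :: "real \<Rightarrow> 'a ugraph \<Rightarrow> ('a \<Rightarrow> real vec) \<Rightarrow> bool" where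
  "vector_coloring t G p \<longleftrightarrow>
     t \<ge> 2 \<and>
     (\<exists>d. \<forall>i\<in>vertices G. p i \<in> carrier_vec d \<and> sqrt (p i \<bullet> p i) = 1) \<and>
     (\<forall>i\<in>vertices G. \<forall>j\<in>vertices G. {i, j} \<in> edges G \<longrightarrow> p i \<bullet> p j \<le> - 1 / (t - 1))"

definition vector_chromatic_number :: "'a ugraph \<Rightarrow> real" where
  "vector_chromatic_number G = (LEAST t. \<exists>p. vector_coloring t G p)"

definition optimal_vector_coloring :: "'a ugraph \<Rightarrow> ('a \<Rightarrow> real vec) \<Rightarrow> bool" where
  "optimal_vector_coloring G p \<longleftrightarrow> vector_coloring (vector_chromatic_number G) G p"

definition uniquely_vector_colorable :: "'a ugraph \<Rightarrow> bool" where
  "uniquely_vector_colorable G \<longleftrightarrow>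
     (\<forall>p q. optimal_vector_coloring G p \<longrightarrow> optimal_vector_coloring G q \<longrightarrow>
        (\<forall>i\<in>vertices G. \<forall>j\<in>vertices G. p i \<bullet> p j = q i \<bullet> q j))"

end

theory Submission
  imports Defs "HOL-Analysis.L2_Norm"
begin

text \<open>
  On an odd cycle with \<open>n\<close> vertices, replace every second vector by its negative. An edge bound
  \<open>- cos \<theta>\<close> then says that consecutive vectors enclose an angle of at most \<open>\<theta>\<close>, and going once
  around the cycle leads from a vector to its antipode. By the triangle inequality for angles
  \<open>\<pi> \<le> n * \<theta>\<close>. If \<open>\<theta> = \<pi> / n\<close>, then for any two vectors \<open>u\<close> and \<open>v\<close> of the walk, \<open>m\<close> steps apart, the
  parts from \<open>u\<close> to \<open>v\<close> and from \<open>v\<close> to \<open>- u\<close> give \<open>\<angle>(u, v) \<le> m * \<theta>\<close> and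
  \<open>\<pi> - \<angle>(u, v) \<le> (n - m) * \<theta>\<close>, which determines the angle.
\<close>

section \<open>Angles between unit vectors\<close>

lemma scalar_prod_Cauchy_Schwarz:
  fixes x y :: "real vec"
  assumes "x \<in> carrier_vec d" "y \<in> carrier_vec d"
  shows "\<bar>x \<bullet> y\<bar> \<le> sqrt (x \<bullet> x) * sqrt (y \<bullet> y)"
proof -
  have "\<bar>x \<bullet> y\<bar> \<le> (\<Sum>i\<in>{0..<d}. \<bar>x $ i\<bar> * \<bar>y $ i\<bar>)"
    using assms sum_abs[of "\<lambda>i. x $ i * y $ i" "{0..<d}"] by (simp add: scalar_prod_def abs_mult)
  also have "\<dots> \<le> L2_set (($) x) {0..<d} * L2_set (($) y) {0..<d}"
    by (rule L2_set_mult_ineq)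
  also have "\<dots> = sqrt (x \<bullet> x) * sqrt (y \<bullet> y)"
    using assms by (simp add: L2_set_def scalar_prod_def power2_eq_square)
  finally show ?thesis .
qed

lemma abs_scalar_prod_unit_le_1:
  fixes u v :: "real vec"
  assumes "u \<in> carrier_vec d" "v \<in> carrier_vec d" "u \<bullet> u = 1" "v \<bullet> v = 1"
  shows "\<bar>u \<bullet> v\<bar> \<le> 1"
  using scalar_prod_Cauchy_Schwarz[OF assms(1,2)] assms by simp

text \<open>Remove from \<open>u\<close> and \<open>w\<close> their components along
  \<open>v\<close>. Cauchy-Schwarz for the remainders and the addition formula give that
  \<open>u \<bullet> w\<close> is at least the cosine of the angle sum. If that sum exceeds
  \<open>pi\<close>, the claim is trivial.\<close>

lemma arccos_scalar_prod_triangle: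
  fixes u v w :: "real vec"
  assumes c: "u \<in> carrier_vec d" "v \<in> carrier_vec d" "w \<in> carrier_vec d"
    and n: "u \<bullet> u = 1" "v \<bullet> v = 1" "w \<bullet> w = 1"
  shows "arccos (u \<bullet> w) \<le> arccos (u \<bullet> v) + arccos (v \<bullet> w)"
proof -
  define a b where "a = u \<bullet> v" and "b = v \<bullet> w"
  have ab: "\<bar>a\<bar> \<le> 1" "\<bar>b\<bar> \<le> 1" and uw: "\<bar>u \<bullet> w\<bar> \<le> 1"
    unfolding a_def b_def using abs_scalar_prod_unit_le_1 c n by blast+
  have comm: "v \<bullet> u = a" "w \<bullet> v = b"
    using c by (simp_all add: a_def b_def comm_scalar_prod)
  define x y where "x = u - a \<cdot>\<^sub>v v" and "y = w - b \<cdot>\<^sub>v v"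
  have xy: "x \<in> carrier_vec d" "y \<in> carrier_vec d" using c by (auto simp: x_def y_def)
  have "x \<bullet> x = 1 - a\<^sup>2" "y \<bullet> y = 1 - b\<^sup>2" "x \<bullet> y = u \<bullet> w - a * b"
    using c n comm a_def[symmetric] b_def[symmetric]
    by (simp_all add: x_def y_def minus_scalar_prod_distrib[of _ d]
        scalar_prod_minus_distrib[of _ d] power2_eq_square algebra_simps)
  with scalar_prod_Cauchy_Schwarz[OF xy]
  have "\<bar>u \<bullet> w - a * b\<bar> \<le> sqrt (1 - a\<^sup>2) * sqrt (1 - b\<^sup>2)" by simp
  then have "a * b - sqrt (1 - a\<^sup>2) * sqrt (1 - b\<^sup>2) \<le> u \<bullet> w" by linarith
  then have le: "cos (arccos a + arccos b) \<le> u \<bullet> w"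
    using ab by (simp add: cos_add sin_arccos abs_le_iff)
  have nonneg: "0 \<le> arccos a + arccos b" using ab by (intro add_nonneg_nonneg arccos_lbound) auto
  show ?thesis
  proof (cases "arccos a + arccos b \<le> pi")
    case True
    have "arccos (u \<bullet> w) \<le> arccos (cos (arccos a + arccos b))"
      using le uw by (intro arccos_le_arccos) auto
    also have "\<dots> = arccos a + arccos b" using True nonneg by (simp add: arccos_cos)
    finally show ?thesis by (simp add: a_def b_def)
  next
    case False
    with uw arccos_ubound[of "u \<bullet> w"] show ?thesis by (simp add: a_def b_def abs_le_iff)
  qed
qed

lemma arccos_scalar_prod_walk:
  fixes y :: "nat \<Rightarrow> real vec"
  assumes "\<And>i. y i \<in> carrier_vec d" "\<And>i. y i \<bullet> y i = 1"
    and "\<And>i. arccos (y i \<bullet> y (Suc i)) \<le> \<theta>"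
  shows "arccos (y i \<bullet> y (i + m)) \<le> m * \<theta>"
proof (induction m)
  case (Suc m)
  have "arccos (y i \<bullet> y (i + Suc m)) \<le>
      arccos (y i \<bullet> y (i + m)) + arccos (y (i + m) \<bullet> y (Suc (i + m)))"
    unfolding add_Suc_right by (rule arccos_scalar_prod_triangle) (rule assms)+
  also have "\<dots> \<le> m * \<theta> + \<theta>" using Suc assms(3) by (rule add_mono)
  finally show ?case by (simp add: algebra_simps)
qed (simp add: assms)

section \<open>Antiperiodic walks on the unit sphere\<close>

context
  fixes y :: "nat \<Rightarrow> real vec" and d n :: nat and \<theta> :: real
  assumes carrier: "\<And>i. y i \<in> carrier_vec d"
    and unit: "\<And>i. y i \<bullet> y i = 1"
    and step: "\<And>i. arccos (y i \<bullet> y (Suc i)) \<le> \<theta>"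
    and antiperiodic: "\<And>i. y (i + n) = - y i"
begin

lemma antiperiodic_walk_angle: "pi \<le> n * \<theta>"
  using arccos_scalar_prod_walk[of y d \<theta> 0 n] carrier unit step antiperiodic[of 0] by simp

lemma antiperiodic_walk_scalar_prod:
  assumes \<theta>: "n * \<theta> = pi" and "m \<le> n"
  shows "y i \<bullet> y (i + m) = cos (m * \<theta>)"
proof -
  have bnd: "\<bar>y i \<bullet> y (i + m)\<bar> \<le> 1"
    by (intro abs_scalar_prod_unit_le_1[of _ d] carrier unit)
  have "arccos (y i \<bullet> y (i + m)) \<le> m * \<theta>"
    by (rule arccos_scalar_prod_walk) (rule carrier unit step)+
  \<comment> \<open>The remaining \<open>n - m\<close> steps lead from \<open>y (i + m)\<close> to
    \<open>y (i + n) = - y i\<close>.\<close>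
  moreover have "arccos (- (y i \<bullet> y (i + m))) \<le> real (n - m) * \<theta>"
  proof -
    have "y (i + m) \<bullet> y (i + m + (n - m)) = - (y i \<bullet> y (i + m))"
      using \<open>m \<le> n\<close> carrier[of i] carrier[of "i + m"]
      by (simp add: antiperiodic comm_scalar_prod[of "y (i + m)" d "y i"])
    then show ?thesis
      using arccos_scalar_prod_walk[of y d \<theta> "i + m" "n - m"] carrier unit step by simp
  qed
  \<comment> \<open>Since \<open>arccos (- x) = pi - arccos x\<close> and
    \<open>n * \<theta> = pi\<close>, the second bound is the reverse of the first.\<close>
  ultimately have "arccos (y i \<bullet> y (i + m)) = m * \<theta>"
    using bnd \<theta> \<open>m \<le> n\<close> by (simp add: arccos_minus abs_le_iff of_nat_diff algebra_simps)
  then show ?thesis using bnd by (metis cos_arccos_abs)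
qed

end

text \<open>Positions count from 0 and vertices from 1, hence \<open>Suc (i mod n)\<close>. The
  alternating sign negates the product along each edge, so an upper bound on it becomes an upper
  bound on the angle. As \<open>n\<close> is odd, a full lap flips the sign.\<close>

lemma odd_cycle_coloring_walk:
  assumes col: "vector_coloring t (cycle_graph n) p" and "odd n" "n \<ge> 3"
  obtains d where
    "\<And>i. (-1) ^ i \<cdot>\<^sub>v p (Suc (i mod n)) \<in> carrier_vec d"
    "\<And>i. ((-1) ^ i \<cdot>\<^sub>v p (Suc (i mod n))) \<bullet> ((-1) ^ i \<cdot>\<^sub>v p (Suc (i mod n))) = 1"
    "\<And>i. arccos (((-1) ^ i \<cdot>\<^sub>v p (Suc (i mod n))) \<bullet> ((-1) ^ Suc i \<cdot>\<^sub>v p (Suc (Suc i mod n))))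
       \<le> arccos (1 / (t - 1))"
    "\<And>i. (-1) ^ (i + n) \<cdot>\<^sub>v p (Suc ((i + n) mod n)) = - ((-1) ^ i \<cdot>\<^sub>v p (Suc (i mod n)))"
proof -
  from col obtain d where "t \<ge> 2"
    and d: "\<And>i. i \<in> {1..n} \<Longrightarrow> p i \<in> carrier_vec d" "\<And>i. i \<in> {1..n} \<Longrightarrow> p i \<bullet> p i = 1"
    and e: "\<And>i j. i \<in> {1..n} \<Longrightarrow> j \<in> {1..n} \<Longrightarrow> {i, j} \<in> edges (cycle_graph n)
      \<Longrightarrow> p i \<bullet> p j \<le> - 1 / (t - 1)"
    unfolding vector_coloring_def by (force simp: cycle_graph_def)
  have V: "Suc (i mod n) \<in> {1..n}" for i using \<open>n \<ge> 3\<close> by (simp add: Suc_le_eq)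
  have E: "{Suc (i mod n), Suc (Suc i mod n)} \<in> edges (cycle_graph n)" for i
  proof (cases "Suc (i mod n) = n")
    case True
    then show ?thesis by (simp add: mod_Suc cycle_graph_def)
  next
    case False
    then have "Suc (i mod n) < n" using V[of i] by simp
    then show ?thesis using False by (auto simp: mod_Suc cycle_graph_def)
  qed
  note dV = d(1)[OF V] d(2)[OF V]
  show thesis
  proof (rule that[of d])
    fix i
    show "(-1) ^ i \<cdot>\<^sub>v p (Suc (i mod n)) \<in> carrier_vec d" using dV by simp
    show "((-1) ^ i \<cdot>\<^sub>v p (Suc (i mod n))) \<bullet> ((-1) ^ i \<cdot>\<^sub>v p (Suc (i mod n))) = 1"
      using dV(1)[of i] dV(2)[of i] by (simp flip: power_add mult.assoc)
    show "(-1) ^ (i + n) \<cdot>\<^sub>v p (Suc ((i + n) mod n)) = - ((-1) ^ i \<cdot>\<^sub>v p (Suc (i mod n)))"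
      using \<open>odd n\<close> by (intro eq_vecI) (simp_all add: power_add)
    have "1 / (t - 1) \<le> - (p (Suc (i mod n)) \<bullet> p (Suc (Suc i mod n)))"
      using e[OF V V E, of i] by simp
    moreover have "\<bar>p (Suc (i mod n)) \<bullet> p (Suc (Suc i mod n))\<bar> \<le> 1"
      by (intro abs_scalar_prod_unit_le_1[of _ d] dV)
    \<comment> \<open>Together with the bound before it, this keeps both arguments in the domain
      where \<open>arccos\<close> is antitone.\<close>
    moreover have "- 1 \<le> 1 / (t - 1)" 
      by (rule order_trans[of _ 0]) (use \<open>t \<ge> 2\<close> in simp_all)
    ultimately have "arccos (- (p (Suc (i mod n)) \<bullet> p (Suc (Suc i mod n)))) \<le> arccos (1 / (t - 1))"
      by (intro arccos_le_arccos) (simp_all only: abs_le_iff minus_le_iff)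
    then show "arccos (((-1) ^ i \<cdot>\<^sub>v p (Suc (i mod n))) \<bullet> ((-1) ^ Suc i \<cdot>\<^sub>v p (Suc (Suc i mod n))))
       \<le> arccos (1 / (t - 1))"
      using dV(1)[of i] dV(1)[of "Suc i"] by (simp flip: power_add mult.assoc)
  qed
qed

section \<open>The vector chromatic number of an odd cycle\<close>

lemma cos_pi_div_bounds:
  assumes "n \<ge> (3::nat)"
  shows "0 < cos (pi / n)" "cos (pi / n) \<le> 1"
  using assms by (auto intro!: cos_gt_zero simp: field_simps)

text \<open>The signed walk has steps of angle at most \<open>arccos (1 / (t - 1))\<close>, so this
  angle is at least \<open>pi / n\<close>. Taking cosines and solving for \<open>t\<close> gives the
  bound.\<close>

lemma odd_cycle_coloring_ge:
  assumes col: "vector_coloring t (cycle_graph n) p" and n: "odd n" "n \<ge> 3"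
  shows "1 + 1 / cos (pi / n) \<le> t"
proof -
  have t: "t \<ge> 2" using col by (simp add: vector_coloring_def)
  have "pi \<le> n * arccos (1 / (t - 1))"
    by (rule odd_cycle_coloring_walk[OF assms], rule antiperiodic_walk_angle)
  then have "pi / n \<le> arccos (1 / (t - 1))" using n by (simp add: field_simps)
  then have "cos (arccos (1 / (t - 1))) \<le> cos (pi / n)"
    using t by (intro cos_monotone_0_pi_le arccos_ubound) (auto simp: field_simps)
  then have "1 / (t - 1) \<le> cos (pi / n)" using t by (simp add: cos_arccos_abs)
  then show ?thesis using t cos_pi_div_bounds[OF n(2)] by (simp add: field_simps)
qed

lemma odd_cycle_coloring_exists:
  assumes n: "odd n" "n \<ge> 3"
  shows "\<exists>p. vector_coloring (1 + 1 / cos (pi / n)) (cycle_graph n) p"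
proof -
  \<comment> \<open>The witness rotates by \<open>\<phi>\<close> in the plane from each vertex to
    the next; consecutive vectors are as far from antipodal as \<open>pi / n\<close>.\<close>
  define \<phi> where "\<phi> = pi - pi / n"
  define p where "p i = vec_of_list [cos (i * \<phi>), sin (i * \<phi>)]" for i :: nat
  have cos_\<phi>: "cos \<phi> = - cos (pi / n)" by (simp add: \<phi>_def)
  have prod: "p i \<bullet> p j = cos (i * \<phi> - j * \<phi>)" for i j
    by (simp add: p_def cos_diff)
  have carrier: "p i \<in> carrier_vec 2" for i
    by (rule carrier_vecI) (simp add: p_def)
  have unit: "sqrt (p i \<bullet> p i) = 1" for i
    by (simp add: prod)
  have comm: "p i \<bullet> p j = p j \<bullet> p i" for i j
    by (simp add: prod cos_diff mult.commute)
  have step: "p i \<bullet> p (Suc i) = - cos (pi / n)" "p (Suc i) \<bullet> p i = - cos (pi / n)" for i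
    using cos_\<phi> by (simp_all add: prod algebra_simps)
  have closing: "p n \<bullet> p 1 = - cos (pi / n)" "p 1 \<bullet> p n = - cos (pi / n)"
  proof -
    from n obtain k where k: "n = 2 * k + 1" by (auto elim: oddE)
    \<comment> \<open>Here \<open>n * \<phi> = (n - 1) * pi\<close> is a multiple of
      \<open>2 * pi\<close> because \<open>n\<close> is odd, so the closing edge has the same angle
      as all others.\<close>
    have "n * \<phi> = 2 * k * pi" using n by (simp add: \<phi>_def k field_simps)
    then have eq: "n * \<phi> - \<phi> = 2 * pi * of_int (int k) - \<phi>" by simp
    have "cos (n * \<phi> - \<phi>) = cos \<phi>"
      unfolding eq cos_diff cos_int_2pin sin_int_2pin by simp
    then show "p n \<bullet> p 1 = - cos (pi / n)" by (simp add: prod cos_\<phi>)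
    then show "p 1 \<bullet> p n = - cos (pi / n)" by (subst comm)
  qed
  have "vector_coloring (1 + 1 / cos (pi / n)) (cycle_graph n) p"
    unfolding vector_coloring_def
  proof (intro conjI)
    show "\<exists>d. \<forall>i\<in>vertices (cycle_graph n). p i \<in> carrier_vec d \<and> sqrt (p i \<bullet> p i) = 1"
      using carrier unit by blast
    show "\<forall>i\<in>vertices (cycle_graph n). \<forall>j\<in>vertices (cycle_graph n).
        {i, j} \<in> edges (cycle_graph n) \<longrightarrow> p i \<bullet> p j \<le> - 1 / (1 + 1 / cos (pi / n) - 1)"
    proof (intro ballI impI)
      fix i j assume "{i, j} \<in> edges (cycle_graph n)"
      then consider "i = n" "j = 1" | "i = 1" "j = n" | "j = Suc i" | "i = Suc j"
        by (auto simp: cycle_graph_def doubleton_eq_iff)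
      then have "p i \<bullet> p j = - cos (pi / n)" by cases (use step closing in simp_all)
      then show "p i \<bullet> p j \<le> - 1 / (1 + 1 / cos (pi / n) - 1)" by simp
    qed
  qed (use cos_pi_div_bounds[OF n(2)] in \<open>simp add: field_simps\<close>)
  then show ?thesis by blast
qed

lemma vector_chromatic_number_odd_cycle:
  assumes n: "odd n" "n \<ge> 3"
  shows "vector_chromatic_number (cycle_graph n) = 1 + 1 / cos (pi / n)"
  unfolding vector_chromatic_number_def
  using odd_cycle_coloring_exists[OF n] odd_cycle_coloring_ge[OF _ n] by (intro Least_equality) auto

text \<open>The right-hand sides do not depend on \<open>p\<close>, which is what uniqueness needs.
  Both orders of the product are stated so that the final proof can split on
  \<open>i \<le> j\<close>.\<close>

lemma optimal_coloring_odd_cycle_scalar_prod: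
  assumes opt: "optimal_vector_coloring (cycle_graph n) p" and n: "odd n" "n \<ge> 3"
    and ij: "1 \<le> i" "i \<le> j" "j \<le> n"
  shows "p i \<bullet> p j = (-1) ^ (j - i) * cos (real (j - i) * (pi / n))"
    and "p j \<bullet> p i = (-1) ^ (j - i) * cos (real (j - i) * (pi / n))"
proof -
  define y where "y i = (-1) ^ i \<cdot>\<^sub>v p (Suc (i mod n))" for i
  \<comment> \<open>At the optimal value the step bound is exactly \<open>pi / n\<close>, the
    equality case for antiperiodic walks.\<close>
  have "arccos (1 / (1 + 1 / cos (pi / n) - 1)) = pi / n"
    using n by (simp add: arccos_cos field_simps)
  with odd_cycle_coloring_walk[OF opt[unfolded optimal_vector_coloring_def
      vector_chromatic_number_odd_cycle[OF n]] n]
  obtain d where d: "\<And>i. y i \<in> carrier_vec d"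
    and walk: "\<And>i. y i \<bullet> y i = 1" "\<And>i. arccos (y i \<bullet> y (Suc i)) \<le> pi / n"
      "\<And>i. y (i + n) = - y i"
    unfolding y_def by metis
  \<comment> \<open>Vertex \<open>l\<close> sits at position \<open>l - 1\<close>, and multiplying
    by the same sign again undoes it.\<close>
  have p: "p l = (-1) ^ (l - 1) \<cdot>\<^sub>v y (l - 1)" if "l \<in> {1..n}" for l
    using that by (auto simp: y_def smult_smult_assoc simp flip: power_add)
  have "y (i - 1) \<bullet> y (i - 1 + (j - i)) = cos (real (j - i) * (pi / n))"
    by (rule antiperiodic_walk_scalar_prod[OF d walk]) (use n ij in auto)
  moreover have "i - 1 + (j - i) = j - 1" using ij by simp
  ultimately have y: "y (i - 1) \<bullet> y (j - 1) = cos (real (j - i) * (pi / n))" by simp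
  \<comment> \<open>The two exponents differ by \<open>2 * (i - 1)\<close>.\<close>
  have "even (j - 1 + (i - 1)) \<longleftrightarrow> even (j - i)" using ij by presburger
  then have sign: "(-1::real) ^ (j - 1) * (-1) ^ (i - 1) = (-1) ^ (j - i)"
    unfolding power_add[symmetric] by (simp only: minus_one_power_iff)
  show eq: "p i \<bullet> p j = (-1) ^ (j - i) * cos (real (j - i) * (pi / n))"
    using ij d[of "i - 1"] d[of "j - 1"] y sign by (simp add: p flip: mult.assoc)
  have "p i \<in> carrier_vec d" "p j \<in> carrier_vec d" using ij d p by simp_all
  then show "p j \<bullet> p i = (-1) ^ (j - i) * cos (real (j - i) * (pi / n))"
    using eq by (simp add: comm_scalar_prod)
qed

theorem theorem4p7:
  fixes k :: nat
  assumes "k \<ge> 1"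
  shows "uniquely_vector_colorable (cycle_graph (2 * k + 1))"
  unfolding uniquely_vector_colorable_def
proof (intro allI impI ballI)
  fix p q i j
  assume opt: "optimal_vector_coloring (cycle_graph (2 * k + 1)) p"
    "optimal_vector_coloring (cycle_graph (2 * k + 1)) q"
    and ij: "i \<in> vertices (cycle_graph (2 * k + 1))" "j \<in> vertices (cycle_graph (2 * k + 1))"
  have n: "odd (2 * k + 1)" "2 * k + 1 \<ge> 3" using assms by auto
  note prods = optimal_coloring_odd_cycle_scalar_prod[OF _ n]
  show "p i \<bullet> p j = q i \<bullet> q j"
  proof (cases "i \<le> j")
    case True
    then show ?thesis using ij prods(1)[OF opt(1)] prods(1)[OF opt(2)]
      by (simp add: cycle_graph_def)
  next
    case False
    then show ?thesis using ij prods(2)[OF opt(1)] prods(2)[OF opt(2)]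
      by (simp add: cycle_graph_def)
  qed
qed

end
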